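(* Let $\mathbb{F}$ be a finite field with a fixed nontrivial additive character $\chi$. Let $f,A_1,\dots,A_m\colon\mathbb{F}^n\to\mathbb{F}$ be any functions and put $\mathbf{A}=(A_1,\dots,A_m)$. Then $$\mathbb{E}_{c\in\mathbb{F}^m}\,\mathfrak{bias}\Big(f-\sum_{i=1}^m c_iA_i\Big)=\mathbb{P}(Z(\mathbf{A}))\cdot\mathfrak{bias}\big(f\,|\,Z(\mathbf{A})\big),$$ where the right-hand side is interpreted as $0$ if $Z(\mathbf{A})=\emptyset$.
   Context: For $F\colon\mathbb{F}^n\to\mathbb{F}$, $\mathfrak{bias}(F)=\mathbb{E}_{x\in\mathbb{F}^n}\chi(F(x))\in\mathbb{C}$ (uniform average). For a nonempty subset $E\subseteq\mathbb{F}^n$, $\mathfrak{bias}(F\,|\,E)=\mathbb{E}[\chi(F)\,|\,E]=\frac{1}{|E|}\sum_{x\in E}\chi(F(x))$. The joint zero set is $Z(\mathbf{A})=\{x\in\mathbb{F}^n : A_i(x)=0\text{ for all } i\}$, and $\mathbb{P}(Z(\mathbf{A}))=|Z(\mathbf{A})|/|\mathbb{F}|^n$. *)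

theory Defs
  imports Complex_Main "HOL-Library.FuncSet" "HOL-Library.Cardinality"
begin

text \<open>The space \<open>F^n\<close>, as functions on the index set \<open>{1..n}\<close> that are \<open>undefined\<close> elsewhere;
  thus \<open>F^n\<close> has exactly \<open>|F|^n\<close> elements, and \<open>n = 0\<close> is allowed.\<close>

definition tuples :: "nat \<Rightarrow> (nat \<Rightarrow> 'a) set" where
  "tuples n = {1..n} \<rightarrow>\<^sub>E UNIV"

text \<open>Homomorphisms from the additive group of \<open>F\<close> to the multiplicative group of nonzero complex
  numbers. For finite \<open>F\<close> the values are automatically roots of unity.\<close>

definition additive_character :: "('a::field \<Rightarrow> complex) \<Rightarrow> bool" where
  "additive_character \<chi> \<longleftrightarrow> (\<forall>x. \<chi> x \<noteq> 0) \<and> (\<forall>x y. \<chi> (x + y) = \<chi> x * \<chi> y)"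

definition nontrivial_additive_character :: "('a::field \<Rightarrow> complex) \<Rightarrow> bool" where
  "nontrivial_additive_character \<chi> \<longleftrightarrow> additive_character \<chi> \<and> (\<exists>x. \<chi> x \<noteq> 1)"

text \<open>Uniform average; only meaningful for finite nonempty sets.\<close>

definition avg :: "'b set \<Rightarrow> ('b \<Rightarrow> complex) \<Rightarrow> complex" where
  "avg E g = (\<Sum>x\<in>E. g x) / of_nat (card E)"

definition bias_on ::
    "('a::field \<Rightarrow> complex) \<Rightarrow> (nat \<Rightarrow> 'a) set \<Rightarrow> ((nat \<Rightarrow> 'a) \<Rightarrow> 'a) \<Rightarrow> complex" where
  "bias_on \<chi> E F = avg E (\<lambda>x. \<chi> (F x))"

definition bias ::
    "('a::field \<Rightarrow> complex) \<Rightarrow> nat \<Rightarrow> ((nat \<Rightarrow> 'a) \<Rightarrow> 'a) \<Rightarrow> complex" where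
  "bias \<chi> n F = avg (tuples n) (\<lambda>x. \<chi> (F x))"

definition zero_set :: "nat \<Rightarrow> nat \<Rightarrow> (nat \<Rightarrow> (nat \<Rightarrow> 'a::field) \<Rightarrow> 'a) \<Rightarrow> (nat \<Rightarrow> 'a) set" where
  "zero_set n m A = {x \<in> tuples n. \<forall>i\<in>{1..m}. A i x = 0}"

definition density :: "nat \<Rightarrow> (nat \<Rightarrow> 'a) set \<Rightarrow> real" where
  "density n E = real (card E) / real (CARD('a)) ^ n"

end

theory Submission
  imports Defs
begin

text \<open>The identity is the Fourier expansion of the indicator function of the zero set. For a fixed
  point \<open>x\<close>, the average over all \<open>c\<close> of \<open>\<chi> (- \<Sum>i. c\<^sub>i A\<^sub>i(x))\<close> is \<open>1\<close> if every \<open>A\<^sub>i(x)\<close>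
  vanishes and \<open>0\<close> otherwise: since \<open>\<chi>\<close> turns sums into products and the \<open>c\<^sub>i\<close> range independently
  over the field, the sum over \<open>c\<close> factors into \<open>m\<close> one-dimensional character sums, and
  orthogonality (\<open>sum_character_mult\<close>) evaluates each of them; the result is
  \<open>sum_character_linear_form\<close>. Exchanging the averages over \<open>c\<close> and \<open>x\<close> therefore leaves
  exactly the terms \<open>\<chi> (f x)\<close> with \<open>x\<close> in the zero set, normalised by the size of the whole space.\<close>

lemma finite_tuples [simp]: "finite (tuples n :: (nat \<Rightarrow> 'a::finite) set)"
  by (simp add: tuples_def finite_PiE)

lemma card_tuples: "card (tuples n :: (nat \<Rightarrow> 'a::finite) set) = CARD('a) ^ n"
  by (simp add: tuples_def card_PiE)

lemma additive_character_0:
  assumes "additive_character \<chi>"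
  shows "\<chi> 0 = 1"
proof -
  have "\<chi> 0 * \<chi> 0 = \<chi> 0 * 1" "\<chi> 0 \<noteq> 0"
    using assms unfolding additive_character_def by (metis add_0 mult_1_right)+
  then show ?thesis by (simp only: mult_cancel_left) simp
qed

lemma additive_character_sum:
  assumes "additive_character \<chi>"
  shows "\<chi> (\<Sum>i\<in>I. g i) = (\<Prod>i\<in>I. \<chi> (g i))"
  using assms
  by (induction I rule: infinite_finite_induct)
     (simp_all add: additive_character_0, simp add: additive_character_def)

text \<open>Translating the summation variable by \<open>z\<close> multiplies the sum by \<open>\<chi> z\<close>. Choosing
  \<open>z\<close> with \<open>\<chi> z \<noteq> 1\<close> forces the sum to vanish.\<close>

lemma sum_nontrivial_character:
  fixes \<chi> :: "'a::{field,finite} \<Rightarrow> complex"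
  assumes "nontrivial_additive_character \<chi>"
  shows "(\<Sum>t\<in>UNIV. \<chi> t) = 0"
proof -
  obtain z where z: "\<chi> z \<noteq> 1" and hom: "\<And>x y. \<chi> (x + y) = \<chi> x * \<chi> y"
    using assms by (auto simp: nontrivial_additive_character_def additive_character_def)
  have "(\<Sum>t\<in>UNIV. \<chi> t) = (\<Sum>t\<in>UNIV. \<chi> (z + t))"
    by (rule sum.reindex_bij_witness[of _ "\<lambda>t. z + t" "\<lambda>t. t - z"]) auto
  also have "\<dots> = \<chi> z * (\<Sum>t\<in>UNIV. \<chi> t)"
    by (simp add: hom sum_distrib_left)
  finally show ?thesis using z by simp
qed

text \<open>For \<open>a \<noteq> 0\<close> multiplication by \<open>a\<close> permutes the field, so the sum is a reindexed form of the
  complete character sum.\<close>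

lemma sum_character_mult:
  fixes \<chi> :: "'a::{field,finite} \<Rightarrow> complex"
  assumes "nontrivial_additive_character \<chi>"
  shows "(\<Sum>t\<in>UNIV. \<chi> (t * a)) = (if a = 0 then of_nat CARD('a) else 0)"
proof (cases "a = 0")
  case True
  have "\<chi> 0 = 1"
    using assms by (simp add: nontrivial_additive_character_def additive_character_0)
  then show ?thesis using True by simp
next
  case False
  have "(\<Sum>t\<in>UNIV. \<chi> (t * a)) = (\<Sum>t\<in>UNIV. \<chi> t)"
    by (rule sum.reindex_bij_witness[of _ "\<lambda>t. t / a" "\<lambda>t. t * a"]) (use False in auto)
  then show ?thesis using False sum_nontrivial_character[OF assms] by simp
qed

text \<open>The sum over \<open>c\<close> of a product whose \<open>i\<close>-th factor depends only on \<open>c\<^sub>i\<close> is the product of the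
  sums over the individual coordinates, so a single nonzero coefficient \<open>a\<^sub>i\<close> kills it.\<close>

lemma sum_character_linear_form:
  fixes \<chi> :: "'a::{field,finite} \<Rightarrow> complex"
  assumes "nontrivial_additive_character \<chi>"
  shows "(\<Sum>c\<in>tuples m. \<chi> (\<Sum>i=1..m. c i * a i)) =
    (if \<forall>i\<in>{1..m}. a i = 0 then of_nat (CARD('a) ^ m) else 0)"
proof -
  have "additive_character \<chi>"
    using assms by (simp add: nontrivial_additive_character_def)
  then have "(\<Sum>c\<in>tuples m. \<chi> (\<Sum>i=1..m. c i * a i)) =
      (\<Sum>c\<in>tuples m. \<Prod>i=1..m. \<chi> (c i * a i))"
    by (simp add: additive_character_sum)
  also have "\<dots> = (\<Prod>i=1..m. \<Sum>t\<in>UNIV. \<chi> (t * a i))"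
    unfolding tuples_def by (subst prod_sum_PiE) auto
  also have "\<dots> = (\<Prod>i=1..m. if a i = 0 then of_nat CARD('a) else 0)"
    by (simp add: sum_character_mult[OF assms])
  also have "\<dots> = (if \<forall>i\<in>{1..m}. a i = 0 then of_nat (CARD('a) ^ m) else 0)"
    by (auto simp: prod_zero_iff)
  finally show ?thesis .
qed

theorem lemma3p1:
  fixes \<chi> :: "'a::{field,finite} \<Rightarrow> complex"
    and n m :: nat
    and f :: "(nat \<Rightarrow> 'a) \<Rightarrow> 'a"
    and A :: "nat \<Rightarrow> (nat \<Rightarrow> 'a) \<Rightarrow> 'a"
  assumes "nontrivial_additive_character \<chi>"
  shows "avg (tuples m) (\<lambda>c. bias \<chi> n (\<lambda>x. f x - (\<Sum>i=1..m. c i * A i x))) =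
    (if zero_set n m A = {} then 0
     else of_real (density n (zero_set n m A)) * bias_on \<chi> (zero_set n m A) f)"
proof -
  let ?Z = "zero_set n m A" and ?q = "of_nat CARD('a) :: complex"
  have hom: "\<chi> (x + y) = \<chi> x * \<chi> y" for x y
    using assms by (simp add: nontrivial_additive_character_def additive_character_def)
  have finZ: "finite ?Z"
    by (simp add: zero_set_def)
  have split: "\<chi> (f x - (\<Sum>i=1..m. c i * A i x)) = \<chi> (f x) * \<chi> (\<Sum>i=1..m. c i * - A i x)" for c x
    by (simp flip: hom add: sum_negf)
  have "(\<Sum>c\<in>tuples m. \<Sum>x\<in>tuples n. \<chi> (f x - (\<Sum>i=1..m. c i * A i x))) =
      (\<Sum>x\<in>tuples n. \<chi> (f x) * (\<Sum>c\<in>tuples m. \<chi> (\<Sum>i=1..m. c i * - A i x)))"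
    unfolding split sum_distrib_left by (rule sum.swap)
  also have "\<dots> = (\<Sum>x\<in>tuples n. if \<forall>i\<in>{1..m}. A i x = 0 then \<chi> (f x) * ?q ^ m else 0)"
    unfolding sum_character_linear_form[OF assms] by (intro sum.cong) auto
  also have "\<dots> = (\<Sum>x\<in>?Z. \<chi> (f x)) * ?q ^ m"
    by (auto simp: zero_set_def sum.inter_filter sum_distrib_right intro!: sum.cong)
  finally have "avg (tuples m) (\<lambda>c. bias \<chi> n (\<lambda>x. f x - (\<Sum>i=1..m. c i * A i x))) =
      (\<Sum>x\<in>?Z. \<chi> (f x)) / ?q ^ n"
    by (simp add: avg_def bias_def card_tuples flip: sum_divide_distrib)
  moreover have "of_real (density n ?Z) * bias_on \<chi> ?Z f = (\<Sum>x\<in>?Z. \<chi> (f x)) / ?q ^ n"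
    if "?Z \<noteq> {}"
    using that finZ by (simp add: density_def bias_on_def avg_def)
  ultimately show ?thesis by auto
qed

end
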